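(* For every positive integer $k$, $2\left(\left\lceil \frac{3}{4}k\right\rceil -1\right) + 1 \leq m_{\mathcal{A}^*}(k)$.
   Context: An axis-parallel strip in $\mathbb{R}^2$ is a set of the form $\{(x,y): x_0<x<x_1\}$ or $\{(x,y): y_0<y<y_1\}$. The family $\mathcal{A}^*$ consists of the hypergraphs whose vertex set is a finite set of axis-parallel strips and each of whose edges is the set of all vertex-strips containing some given point $(x,y)\in\mathbb{R}^2$. A polychromatic $k$-coloring of a hypergraph is a coloring of its vertices with $k$ colors such that every edge contains a vertex of each of the $k$ colors. For a hypergraph $H$, $H_{\ge m}$ is obtained from $H$ by deleting all edges of size less than $m$. For a hypergraph family $\mathcal{H}$, $m_{\mathcal{H}}(k)$ is the smallest positive integer $m$ such that $H_{\ge m}$ has a polychromatic $k$-coloring for every $H\in\mathcal{H}$, and $m_{\mathcal{H}}(k)=\infty$ if no such $m$ exists. *)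

theory Defs
  imports Complex_Main "HOL-Library.Extended_Nat"
begin

type_synonym 'a hypergraph = "'a set \<times> 'a set set"

abbreviation verts :: "'a hypergraph \<Rightarrow> 'a set" where
  "verts H \<equiv> fst H"

abbreviation edges :: "'a hypergraph \<Rightarrow> 'a set set" where
  "edges H \<equiv> snd H"

(* card is 0 on infinite sets, hence the explicit finiteness test. *)
definition restrict_ge :: "'a hypergraph \<Rightarrow> nat \<Rightarrow> 'a hypergraph" where
  "restrict_ge H m = (verts H, edges H - {e. finite e \<and> card e < m})"

definition polychromatic_coloring :: "nat \<Rightarrow> 'a hypergraph \<Rightarrow> ('a \<Rightarrow> nat) \<Rightarrow> bool" where
  "polychromatic_coloring k H c \<longleftrightarrow>
     (\<forall>v\<in>verts H. c v < k) \<and> (\<forall>e\<in>edges H. \<forall>i<k. \<exists>v\<in>e. c v = i)"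

definition polychromatic_threshold :: "'a hypergraph set \<Rightarrow> nat \<Rightarrow> nat \<Rightarrow> bool" where
  "polychromatic_threshold \<H> k m \<longleftrightarrow>
     m > 0 \<and> (\<forall>H\<in>\<H>. \<exists>c. polychromatic_coloring k (restrict_ge H m) c)"

definition m_number :: "'a hypergraph set \<Rightarrow> nat \<Rightarrow> enat" where
  "m_number \<H> k =
     (if \<exists>m. polychromatic_threshold \<H> k m
      then enat (LEAST m. polychromatic_threshold \<H> k m) else \<infinity>)"

(* Degenerate bounds give the empty strip, which lies in no edge of a strip hypergraph. *)
definition axis_parallel_strip :: "(real \<times> real) set \<Rightarrow> bool" where
  "axis_parallel_strip S \<longleftrightarrow>
     (\<exists>x0 x1. S = {(x, y). x0 < x \<and> x < x1}) \<or> (\<exists>y0 y1. S = {(x, y). y0 < y \<and> y < y1})"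

(* The edge set need not realise every point of the plane. *)
definition strip_hypergraphs :: "(real \<times> real) set hypergraph set" where
  "strip_hypergraphs =
     {H. finite (verts H) \<and> (\<forall>S\<in>verts H. axis_parallel_strip S) \<and>
         (\<forall>e\<in>edges H. \<exists>p. e = {S\<in>verts H. p \<in> S})}"

end

theory Submission
  imports Defs
begin

text \<open>
  With \<open>t = \<lceil>3k/4\<rceil> - 1\<close>, take in each of the two directions \<open>t\<close> ``left'' and \<open>t\<close> ``right'' strips
  so that some lines meet exactly the left ones, exactly the right ones, all, or none of them.
  In a polychromatic colouring of the points covered \<open>2 t\<close> times, every colour occurs among the
  vertical and among the horizontal strips (points covered in one direction only), and, by the four
  left/right combinations, on both sides of one of the two directions. So every colour is used at
  least three times among \<open>4 t\<close> strips, whence \<open>3 k \<le> 4 t\<close>, a contradiction.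
\<close>

text \<open>The varying endpoint keeps the intervals distinct for distinct \<open>j\<close>, since
  vertices form a set. The fixed endpoints, 1 here and -1 in \<open>right_interval\<close>, are
  excluded because the intervals are open, so they serve as test points.\<close>

definition left_interval :: "nat \<Rightarrow> real set" where
  "left_interval j = {- 2 - real j<..<1}"

definition right_interval :: "nat \<Rightarrow> real set" where
  "right_interval j = {- 1<..<2 + real j}"

definition left_intervals :: "nat \<Rightarrow> real set set" where
  "left_intervals t = left_interval ` {..<t}"

definition right_intervals :: "nat \<Rightarrow> real set set" where
  "right_intervals t = right_interval ` {..<t}"

definition intervals_at :: "nat \<Rightarrow> real \<Rightarrow> real set set" where
  "intervals_at t x = {I \<in> left_intervals t \<union> right_intervals t. x \<in> I}"

definition vertical :: "real set \<Rightarrow> (real \<times> real) set" where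
  "vertical I = I \<times> UNIV"

definition horizontal :: "real set \<Rightarrow> (real \<times> real) set" where
  "horizontal I = UNIV \<times> I"

definition strip_grid :: "nat \<Rightarrow> (real \<times> real) set set" where
  "strip_grid t = vertical ` (left_intervals t \<union> right_intervals t) \<union>
                  horizontal ` (left_intervals t \<union> right_intervals t)"

definition strip_grid_hypergraph :: "nat \<Rightarrow> (real \<times> real) set hypergraph" where
  "strip_grid_hypergraph t = (strip_grid t, range (\<lambda>p. {S \<in> strip_grid t. p \<in> S}))"

lemma open_interval_eq_iff:
  fixes a b c d :: real
  assumes "a < b" "c < d"
  shows "{a<..<b} = {c<..<d} \<longleftrightarrow> a = c \<and> b = d"
  using assms greaterThanLessThan_subseteq_greaterThanLessThan[of a b c d]
    greaterThanLessThan_subseteq_greaterThanLessThan[of c d a b]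
  by auto

lemma finite_intervals [simp]: "finite (left_intervals t)" "finite (right_intervals t)"
  by (simp_all add: left_intervals_def right_intervals_def)

lemma finite_intervals_at [simp]: "finite (intervals_at t x)"
  by (simp add: intervals_at_def)

lemma card_left_intervals [simp]: "card (left_intervals t) = t"
proof -
  have "inj left_interval"
    by (auto simp: inj_def left_interval_def open_interval_eq_iff)
  then show ?thesis
    by (simp add: left_intervals_def card_image inj_on_subset)
qed

lemma card_right_intervals [simp]: "card (right_intervals t) = t"
proof -
  have "inj right_interval"
    by (auto simp: inj_def right_interval_def open_interval_eq_iff)
  then show ?thesis
    by (simp add: right_intervals_def card_image inj_on_subset)
qed

lemma left_right_disjoint: "left_intervals t \<inter> right_intervals t = {}"
  by (auto simp: left_intervals_def right_intervals_def left_interval_def right_interval_def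
      open_interval_eq_iff)

text \<open>The indices stop at \<open>t - 1\<close>, so no right interval reaches beyond
  \<open>1 + real t\<close>; hence \<open>2 + real t\<close> avoids all intervals.\<close>

lemma intervals_at_simps:
  "intervals_at t (- 1) = left_intervals t"
  "intervals_at t 0 = left_intervals t \<union> right_intervals t"
  "intervals_at t 1 = right_intervals t"
  "intervals_at t (2 + real t) = {}"
  by (auto simp: intervals_at_def left_intervals_def right_intervals_def
      left_interval_def right_interval_def)

text \<open>Rules out the whole plane, which would be both a vertical and a horizontal
  strip.\<close>

lemma intervals_neq_UNIV: "I \<in> left_intervals t \<union> right_intervals t \<Longrightarrow> I \<noteq> UNIV"
proof -
  have "{a<..<b} \<noteq> UNIV" for a b :: real
    by (metis UNIV_I greaterThanLessThan_iff less_irrefl)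
  then show "I \<in> left_intervals t \<union> right_intervals t \<Longrightarrow> I \<noteq> UNIV"
    by (auto simp: left_intervals_def right_intervals_def left_interval_def right_interval_def)
qed

lemma inj_vertical: "inj vertical" and inj_horizontal: "inj horizontal"
  by (auto simp: inj_def vertical_def horizontal_def times_eq_iff)

lemma strips_containing_point:
  "{S \<in> strip_grid t. (x, y) \<in> S} = vertical ` intervals_at t x \<union> horizontal ` intervals_at t y"
  by (auto simp: strip_grid_def intervals_at_def vertical_def horizontal_def)

lemma card_strips_containing_point:
  "card {S \<in> strip_grid t. (x, y) \<in> S} = card (intervals_at t x) + card (intervals_at t y)"
proof -
  \<comment> \<open>A product \<open>I \<times> UNIV\<close> equals \<open>UNIV \<times> J\<close>
    only if both are empty or both are the plane. The intervals here are nonempty, as they contain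
    \<open>x\<close> or \<open>y\<close>.\<close>
  have "vertical ` intervals_at t x \<inter> horizontal ` intervals_at t y = {}"
    using intervals_neq_UNIV
    by (fastforce simp: intervals_at_def vertical_def horizontal_def times_eq_iff)
  then show ?thesis
    unfolding strips_containing_point
    by (simp add: card_Un_disjoint card_image inj_on_subset[OF inj_vertical]
        inj_on_subset[OF inj_horizontal])
qed

lemma strip_grid_hypergraph_in: "strip_grid_hypergraph t \<in> strip_hypergraphs"
proof -
  have "axis_parallel_strip S" if "S \<in> strip_grid t" for S
  proof -
    have ivl: "\<exists>a b. I = {a<..<b}" if "I \<in> left_intervals t \<union> right_intervals t" for I
      using that
      by (auto simp: left_intervals_def right_intervals_def left_interval_def right_interval_def)
    have "\<exists>a b. S = vertical {a<..<b} \<or> S = horizontal {a<..<b}"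
      using that ivl unfolding strip_grid_def by blast
    moreover have "vertical {a<..<b} = {(x, y). a < x \<and> x < b}"
      "horizontal {a<..<b} = {(x, y). a < y \<and> y < b}" for a b
      by (auto simp: vertical_def horizontal_def)
    ultimately show ?thesis
      unfolding axis_parallel_strip_def by metis
  qed
  then show ?thesis
    by (auto simp: strip_hypergraphs_def strip_grid_hypergraph_def) (simp add: strip_grid_def)
qed

text \<open>Inclusion-exclusion: the two images cover \<open>k\<close> values, and each common value
  is counted twice.\<close>

lemma card_image_Int_le:
  assumes "finite A" "finite B" "{..<k} \<subseteq> f ` (A \<union> B)"
  shows "card (f ` A \<inter> f ` B) + k \<le> card A + card B"
proof -
  have "k \<le> card (f ` A \<union> f ` B)"
    using assms card_mono[of "f ` A \<union> f ` B" "{..<k}"] by (simp add: image_Un)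
  moreover have "card (f ` A) + card (f ` B) = card (f ` A \<union> f ` B) + card (f ` A \<inter> f ` B)"
    using assms by (intro card_Un_Int) auto
  ultimately show ?thesis
    using card_image_le[OF assms(1), of f] card_image_le[OF assms(2), of f] by linarith
qed

lemma polychromatic_strip_grid_bound:
  assumes col: "polychromatic_coloring k (restrict_ge (strip_grid_hypergraph t) m) c"
    and "m \<le> 2 * t"
  shows "3 * k \<le> 4 * t"
proof -
  let ?L = "left_intervals t" and ?R = "right_intervals t"
  let ?v = "\<lambda>I. c (vertical I)" and ?h = "\<lambda>I. c (horizontal I)"
  \<comment> \<open>An edge of size exactly \<open>2 * t\<close> survives the restriction because
    \<open>m \<le> 2 * t\<close>, so it shows all colours.\<close>
  have hit: "{..<k} \<subseteq> ?v ` intervals_at t x \<union> ?h ` intervals_at t y"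
    if "card (intervals_at t x) + card (intervals_at t y) = 2 * t" for x y
  proof -
    let ?e = "{S \<in> strip_grid t. (x, y) \<in> S}"
    have "?e \<in> edges (restrict_ge (strip_grid_hypergraph t) m)"
      using that \<open>m \<le> 2 * t\<close>
      by (auto simp: restrict_ge_def strip_grid_hypergraph_def card_strips_containing_point)
    with col have "\<exists>S\<in>?e. c S = i" if "i < k" for i
      using that unfolding polychromatic_coloring_def by blast
    then have "{..<k} \<subseteq> c ` ?e"
      by blast
    then show ?thesis
      by (simp add: strips_containing_point image_Un image_image)
  qed
  have card_LR: "card (?L \<union> ?R) = 2 * t"
    by (simp add: card_Un_disjoint left_right_disjoint)
  \<comment> \<open>The height \<open>2 + real t\<close> meets no horizontal strip, so the vertical
    ones alone must show every colour.\<close>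
  have "{..<k} \<subseteq> ?v ` (?L \<union> ?R)"
    using hit[of 0 "2 + real t"] by (simp add: intervals_at_simps card_LR)
  then have v: "card (?v ` ?L \<inter> ?v ` ?R) + k \<le> 2 * t"
    using card_image_Int_le[of ?L ?R k ?v] by simp
  have "{..<k} \<subseteq> ?h ` (?L \<union> ?R)"
    using hit[of "2 + real t" 0] by (simp add: intervals_at_simps card_LR)
  then have h: "card (?h ` ?L \<inter> ?h ` ?R) + k \<le> 2 * t"
    using card_image_Int_le[of ?L ?R k ?h] by simp
  have "{..<k} \<subseteq> ?v ` ?L \<union> ?h ` ?L" "{..<k} \<subseteq> ?v ` ?L \<union> ?h ` ?R"
    "{..<k} \<subseteq> ?v ` ?R \<union> ?h ` ?L" "{..<k} \<subseteq> ?v ` ?R \<union> ?h ` ?R"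
    using hit[of "-1" "-1"] hit[of "-1" 1] hit[of 1 "-1"] hit[of 1 1]
    by (simp_all add: intervals_at_simps)
  \<comment> \<open>A colour missing from one vertical side and from one horizontal side would be
    missing from the edge that combines these two sides.\<close>
  then have "{..<k} \<subseteq> (?v ` ?L \<inter> ?v ` ?R) \<union> (?h ` ?L \<inter> ?h ` ?R)"
    by blast
  then have "card {..<k} \<le> card ((?v ` ?L \<inter> ?v ` ?R) \<union> (?h ` ?L \<inter> ?h ` ?R))"
    by (intro card_mono) auto
  then have "k \<le> card (?v ` ?L \<inter> ?v ` ?R) + card (?h ` ?L \<inter> ?h ` ?R)"
    using card_Un_le[of "?v ` ?L \<inter> ?v ` ?R" "?h ` ?L \<inter> ?h ` ?R"] by simp
  \<comment> \<open>Adding \<open>v\<close> and \<open>h\<close> bounds the two intersection sizes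
    plus \<open>2 * k\<close> by \<open>4 * t\<close>; the intersections contribute at least
    \<open>k\<close>.\<close>
  with v h show ?thesis
    by linarith
qed

theorem theorem2:
  fixes k :: nat
  assumes "k > 0"
  shows "enat (nat (2 * (\<lceil>3 / 4 * real k\<rceil> - 1) + 1)) \<le> m_number strip_hypergraphs k"
proof -
  define t where "t = nat (\<lceil>3 / 4 * real k\<rceil> - 1)"
  have pos: "\<lceil>3 / 4 * real k\<rceil> \<ge> 1"
    using assms by (simp add: one_le_ceiling)
  \<comment> \<open>Positivity of \<open>k\<close> keeps \<open>nat\<close> from truncating a
    negative value.\<close>
  then have t: "int t = \<lceil>3 / 4 * real k\<rceil> - 1"
    by (simp add: t_def)
  then have "real t < 3 / 4 * real k"
    by linarith
  then have small: "4 * t < 3 * k"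
    by linarith
  have "2 * t + 1 \<le> m" if threshold: "polychromatic_threshold strip_hypergraphs k m" for m
  proof (rule ccontr)
    assume "\<not> 2 * t + 1 \<le> m"
    then have "m \<le> 2 * t"
      by simp
    moreover obtain c where "polychromatic_coloring k (restrict_ge (strip_grid_hypergraph t) m) c"
      using threshold strip_grid_hypergraph_in unfolding polychromatic_threshold_def by blast
    ultimately show False
      using polychromatic_strip_grid_bound small by fastforce
  qed
  \<comment> \<open>If no threshold exists the value is \<infinity>; otherwise the least threshold
    obeys the bound just shown.\<close>
  then have "enat (2 * t + 1) \<le> m_number strip_hypergraphs k"
    by (auto simp: m_number_def intro: LeastI2)
  moreover have "nat (2 * (\<lceil>3 / 4 * real k\<rceil> - 1) + 1) = 2 * t + 1"
    unfolding t[symmetric] by linarith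
  ultimately show ?thesis
    by simp
qed

end
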